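(* Let $u\in\mathbb{P}^{(m)'}$ be a zero class functional with Pearson-type equation $D(u\alpha I)=u\Psi$, where $\alpha(x)=\alpha_0+\alpha_1x+\alpha_2x^2\in\mathbb{P}_2\setminus\{0\}$ and $\Psi(x)=\psi_0+\psi_1x\in\mathbb{P}_1^{(m)}$. Put $M_n=\psi_1+n\alpha_2I$ and $V_n=M_nM_{n+1}\cdots M_{2n+1}$. (i) If $(P_n)$ is the sequence of monic matrix orthogonal polynomials (MOP) with respect to $u$ and $E_n=\langle x^nP_n,u\rangle$, then for every $n\ge1$ $$\alpha P_n''+E_nV_{n-1}\Psi V_{n-1}^{-1}E_n^{-1}P_n'-nE_nM_{n-1}E_n^{-1}P_n=0.$$ (ii) If $(Q_n)$ is the sequence of MOP with respect to $u$ such that $Q_n$ has leading coefficient $\kappa_n=(E_nV_{n-1})^{-1}$, then for every $n\ge1$ $$\alpha Q_n''+\Psi Q_n'-nM_{n-1}Q_n=0.$$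
   Context: Fix $m\ge 1$. $\mathbb{C}^{(m,m)}$ is the set of $m\times m$ complex matrices and $I$ the identity matrix. $\mathbb{P}^{(m)}$ is the left $\mathbb{C}^{(m,m)}$-module of polynomials in $x$ with coefficients in $\mathbb{C}^{(m,m)}$, $\mathbb{P}^{(m)}_n$ the subset of those of degree at most $n$, and $\mathbb{P}_n$ the scalar complex polynomials of degree at most $n$. $\mathbb{P}^{(m)'}$ is the set of left-$\mathbb{C}^{(m,m)}$-linear maps $u:\mathbb{P}^{(m)}\to\mathbb{C}^{(m,m)}$, and $\langle P,u\rangle=u(P)$. For $Q(x)=\sum_k q_kx^k\in\mathbb{P}^{(m)}$, the functional $uQ$ is defined by $\langle P,uQ\rangle=\sum_k\langle x^kP,u\rangle q_k$. The derivative $Du$ is defined by $\langle P,Du\rangle=-\langle P',u\rangle$. The moments of $u$ are $\mu_n=\langle x^nI,u\rangle$, $\Delta_n=(\mu_{i+j})_{i,j=0}^n$ is the block Hankel matrix, and $u$ is quasi-definite if $\det\Delta_n\ne0$ for all $n\ge0$. This is equivalent to the existence of a sequence of (left) MOP with respect to $u$, i.e. $(Q_n)_{n\ge0}$ with $Q_n\in\mathbb{P}^{(m)}$, $\deg Q_n=n$, non-singular leading coefficient, $\langle x^kQ_n,u\rangle=0$ for $0\le k<n$, and $\langle x^nQ_n,u\rangle$ non-singular; it is unique up to non-singular left matrix factors. $u$ is a zero class functional if it is quasi-definite and satisfies $D(u\alpha I)=u\Psi$ for some $\alpha\in\mathbb{P}_2\setminus\{0\}$, $\Psi\in\mathbb{P}^{(m)}_1$.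 For such $u$ it is known that $M_n$ is non-singular for all $n\ge0$, so $V_n$ is non-singular for $n\ge0$. *)

theory Defs
  imports "HOL-Analysis.Analysis" "HOL-Computational_Algebra.Polynomial"
begin

text \<open>
  Matrix polynomials are library polynomials with coefficients in \<^typ>\<open>complex^'m^'m\<close>.
  The library product and \<^const>\<open>pderiv\<close> are not usable for them: the product \<open>*\<close> on vectors is
  componentwise, and the matrix product is not commutative. Only the additive
  structure, \<^const>\<open>coeff\<close>, \<^const>\<open>degree\<close> and \<^const>\<open>lead_coeff\<close> are taken from the library.
  A constant matrix \<open>A\<close> acts on a polynomial as the constant polynomial \<open>[:A:]\<close>.
\<close>

type_synonym 'm cmat = "complex^'m^'m"
type_synonym 'm functional = "'m cmat poly \<Rightarrow> 'm cmat"

definition mp_mult :: "('m::finite) cmat poly \<Rightarrow> 'm cmat poly \<Rightarrow> 'm cmat poly"  (infixl "\<odot>" 70) where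
  "P \<odot> Q = (\<Sum>i\<le>degree P. \<Sum>j\<le>degree Q. monom (coeff P i ** coeff Q j) (i + j))"

definition mp_deriv :: "('m::finite) cmat poly \<Rightarrow> 'm cmat poly" where
  "mp_deriv P = (\<Sum>i\<le>degree P. monom (real i *\<^sub>R coeff P i) (i - 1))"

abbreviation mp_X :: "nat \<Rightarrow> ('m::finite) cmat poly" where
  "mp_X n \<equiv> monom (mat 1) n"

text \<open>The matrix polynomial \<open>\<alpha> I\<close> for a scalar polynomial \<open>\<alpha>\<close>.\<close>

definition scalar_mp :: "complex poly \<Rightarrow> ('m::finite) cmat poly" where
  "scalar_mp \<alpha> = map_poly mat \<alpha>"

definition left_linear :: "('m::finite) functional \<Rightarrow> bool" where
  "left_linear u \<longleftrightarrow> (\<forall>P Q. u (P + Q) = u P + u Q) \<and> (\<forall>A P. u ([:A:] \<odot> P) = A ** u P)"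

definition fun_mult :: "('m::finite) functional \<Rightarrow> 'm cmat poly \<Rightarrow> 'm functional" where
  "fun_mult u Q = (\<lambda>P. \<Sum>k\<le>degree Q. u (mp_X k \<odot> P) ** coeff Q k)"

definition fun_deriv :: "('m::finite) functional \<Rightarrow> 'm functional" where
  "fun_deriv u = (\<lambda>P. - u (mp_deriv P))"

definition moment :: "('m::finite) functional \<Rightarrow> nat \<Rightarrow> 'm cmat" where
  "moment u n = u (mp_X n)"

text \<open>
  The block Hankel matrix has size \<open>(n + 1) m\<close> with \<open>n\<close> varying, so it cannot be typed as
  \<open>complex^'k^'k\<close>. It is indexed by the pairs (block, position in the block), and
  its determinant is the Leibniz sum over that finite index set, exactly as in the
  definition of \<^const>\<open>det\<close> (lemma \<open>det_on_UNIV\<close>).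
\<close>

definition det_on :: "'i set \<Rightarrow> ('i \<Rightarrow> 'i \<Rightarrow> 'a::comm_ring_1) \<Rightarrow> 'a" where
  "det_on S A = (\<Sum>p | p permutes S. of_int (sign p) * (\<Prod>i\<in>S. A i (p i)))"

lemma det_on_UNIV: "det_on UNIV (\<lambda>i j. A $ i $ j) = det A"
  by (simp add: det_on_def det_def)

definition hankel :: "('m::finite) functional \<Rightarrow> nat \<times> 'm \<Rightarrow> nat \<times> 'm \<Rightarrow> complex" where
  "hankel u = (\<lambda>(i, a) (j, b). moment u (i + j) $ a $ b)"

definition quasi_definite :: "('m::finite) functional \<Rightarrow> bool" where
  "quasi_definite u \<longleftrightarrow> (\<forall>n. det_on ({..n} \<times> UNIV) (hankel u) \<noteq> 0)"

definition pearson :: "('m::finite) functional \<Rightarrow> complex poly \<Rightarrow> 'm cmat poly \<Rightarrow> bool" where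
  "pearson u \<alpha> \<Psi> \<longleftrightarrow> fun_deriv (fun_mult u (scalar_mp \<alpha>)) = fun_mult u \<Psi>"

definition zero_class_functional :: "('m::finite) functional \<Rightarrow> bool" where
  "zero_class_functional u \<longleftrightarrow> left_linear u \<and> quasi_definite u \<and>
     (\<exists>\<alpha> \<Psi>. \<alpha> \<noteq> 0 \<and> degree \<alpha> \<le> 2 \<and> degree \<Psi> \<le> 1 \<and> pearson u \<alpha> \<Psi>)"

definition MOP :: "('m::finite) functional \<Rightarrow> (nat \<Rightarrow> 'm cmat poly) \<Rightarrow> bool" where
  "MOP u Q \<longleftrightarrow> (\<forall>n. degree (Q n) = n \<and> invertible (lead_coeff (Q n)) \<and>
     (\<forall>k<n. u (mp_X k \<odot> Q n) = 0) \<and> invertible (u (mp_X n \<odot> Q n)))"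

definition monic_MOP :: "('m::finite) functional \<Rightarrow> (nat \<Rightarrow> 'm cmat poly) \<Rightarrow> bool" where
  "monic_MOP u P \<longleftrightarrow> MOP u P \<and> (\<forall>n. lead_coeff (P n) = mat 1)"

definition M_mat :: "complex \<Rightarrow> ('m::finite) cmat \<Rightarrow> nat \<Rightarrow> 'm cmat" where
  "M_mat \<alpha>\<^sub>2 \<psi>\<^sub>1 n = \<psi>\<^sub>1 + mat (of_nat n * \<alpha>\<^sub>2)"

definition V_mat :: "complex \<Rightarrow> ('m::finite) cmat \<Rightarrow> nat \<Rightarrow> 'm cmat" where
  "V_mat \<alpha>\<^sub>2 \<psi>\<^sub>1 n = foldr (\<lambda>k A. M_mat \<alpha>\<^sub>2 \<psi>\<^sub>1 k ** A) [n..<2 * n + 2] (mat 1)"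

lemma matrix_zero_mult [simp]: "(0::('m::finite) cmat) ** A = 0" "A ** (0::'m cmat) = 0"
  by (simp_all add: matrix_matrix_mult_def vec_eq_iff)

lemma coeff_mp_mult:
  fixes P Q :: "('m::finite) cmat poly"
  shows "coeff (P \<odot> Q) n = (\<Sum>i\<le>n. coeff P i ** coeff Q (n - i))"
proof -
  have inner: "(\<Sum>j\<le>degree Q. if i + j = n then coeff P i ** coeff Q j else 0) =
    (if i \<le> n then coeff P i ** coeff Q (n - i) else 0)" for i
  proof (cases "i \<le> n")
    case True
    then have "(\<Sum>j\<le>degree Q. if i + j = n then coeff P i ** coeff Q j else 0) =
        (\<Sum>j\<le>degree Q. if j = n - i then coeff P i ** coeff Q j else 0)"
      by (intro sum.cong) auto
    also have "\<dots> = coeff P i ** coeff Q (n - i)"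
      by (simp add: sum.delta coeff_eq_0)
    finally show ?thesis using True by simp
  qed (auto intro!: sum.neutral)
  have "coeff (P \<odot> Q) n =
      (\<Sum>i\<le>degree P. if i \<le> n then coeff P i ** coeff Q (n - i) else 0)"
    by (simp add: mp_mult_def coeff_sum inner)
  also have "\<dots> = (\<Sum>i\<in>{..degree P} \<inter> {..n}. coeff P i ** coeff Q (n - i))"
    by (subst sum.inter_restrict) auto
  also have "\<dots> = (\<Sum>i\<le>n. coeff P i ** coeff Q (n - i))"
    by (intro sum.mono_neutral_left) (auto, metis coeff_eq_0 matrix_zero_mult(1) not_le)
  finally show ?thesis .
qed

lemma coeff_mp_deriv:
  fixes P :: "('m::finite) cmat poly"
  shows "coeff (mp_deriv P) n = real (Suc n) *\<^sub>R coeff P (Suc n)"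
proof -
  have "coeff (mp_deriv P) n = (\<Sum>i\<le>degree P. if i - 1 = n then real i *\<^sub>R coeff P i else 0)"
    by (simp add: mp_deriv_def coeff_sum)
  also have "\<dots> = (\<Sum>i\<le>degree P. if i = Suc n then real i *\<^sub>R coeff P i else 0)"
    by (intro sum.cong) auto
  also have "\<dots> = real (Suc n) *\<^sub>R coeff P (Suc n)"
    by (simp add: sum.delta coeff_eq_0)
  finally show ?thesis .
qed

lemma coeff_scalar_mp: "coeff (scalar_mp \<alpha> :: ('m::finite) cmat poly) n = mat (coeff \<alpha> n)"
  unfolding scalar_mp_def by (rule coeff_map_poly) (simp add: mat_def vec_eq_iff)

end

theory Submission
  imports Defs
begin

text \<open>
  Both parts are one statement about the left multiple \<open>Q = (E\<^sub>n V\<^sub>n\<^sub>-\<^sub>1)\<^sup>-\<^sup>1 P\<^sub>n\<close>, because every MOP sequence consists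
  of left multiples of the \<open>P\<^sub>n\<close> and \<open>V\<^sub>n\<^sub>-\<^sub>1\<close> commutes with \<open>M\<^sub>n\<^sub>-\<^sub>1\<close>. The Pearson equation shows that the
  derivatives \<open>P'\<^sub>n\<^sub>+\<^sub>1\<close> are orthogonal with respect to \<open>u \<alpha>\<close>, which satisfies a Pearson equation with
  \<open>\<Psi> + \<alpha>'\<close> in place of \<open>\<Psi>\<close>. By induction on \<open>n\<close>, over all such functionals, the derivative of
  \<open>\<alpha> Q'' + \<Psi> Q' - n M\<^sub>n\<^sub>-\<^sub>1 Q\<close> is zero, so this polynomial is a constant \<open>c\<close>. Pairing it with \<open>u \<alpha>\<close>
  gives \<open>c \<langle>I, u \<alpha>\<rangle> = 0\<close>, and \<open>\<langle>I, u \<alpha>\<rangle>\<close> is invertible.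
\<close>

subsection \<open>Matrix arithmetic\<close>

text \<open>Complex scalars enter both as \<open>mat c\<close> and through real scalings. Both are
  brought into this one form, which moves out of products on either side.\<close>

definition mscale :: "complex \<Rightarrow> 'm::finite cmat \<Rightarrow> 'm cmat" where
  "mscale c A = (\<chi> i j. c * A $ i $ j)"

lemma mscale_mult_left: "mscale c A ** B = mscale c (A ** B)"
  by (simp add: mscale_def matrix_matrix_mult_def vec_eq_iff sum_distrib_left mult.assoc)

lemma mscale_mult_right: "A ** mscale c B = mscale c (A ** B)"
  by (simp add: mscale_def matrix_matrix_mult_def vec_eq_iff sum_distrib_left mult.left_commute)

lemma mscale_distrib:
  "mscale c (A + B) = mscale c A + mscale c B"
  "mscale (c + d) A = mscale c A + mscale d A"
  "mscale c (A - B) = mscale c A - mscale c B"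
  "mscale (c - d) A = mscale c A - mscale d A"
  "mscale c (- A) = - mscale c A"
  "mscale (- c) A = - mscale c A"
  by (simp_all add: mscale_def vec_eq_iff algebra_simps)

lemma mscale_simps [simp]:
  "mscale c (mscale d A) = mscale (c * d) A"
  "mscale 0 A = 0" "mscale 1 A = A" "mscale c 0 = 0"
  by (simp_all add: mscale_def vec_eq_iff)

lemma mat_eq_mscale: "mat c = mscale c (mat 1)"
  by (simp add: mscale_def mat_def vec_eq_iff)

lemma mat_mult_eq_mscale: "mat c ** A = mscale c A" "A ** mat c = mscale c A"
  by (simp_all add: mat_eq_mscale[of c] mscale_mult_left mscale_mult_right)

lemma mat_commute: "mat c ** A = A ** mat c" for A :: "'m::finite cmat"
  by (simp add: mat_mult_eq_mscale)

lemma mat_add: "mat (a + b) = mat a + (mat b :: 'm::finite cmat)"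
  by (simp add: mat_def vec_eq_iff)

lemma matrix_mult_uminus: "(- A) ** B = - (A ** B)" "A ** (- B) = - (A ** B)"
  for A B :: "'m::finite cmat"
  by (simp_all add: matrix_matrix_mult_def vec_eq_iff sum_negf)

lemma matrix_diff_distrib: "A ** (B - C) = A ** B - A ** C" "(A - B) ** C = A ** C - B ** C"
  for A B C :: "'m::finite cmat"
  by (simp_all add: matrix_matrix_mult_def vec_eq_iff sum_subtractf algebra_simps)

lemma matrix_add_rdistrib: "(A + B) ** C = A ** C + B ** C" for A B C :: "'m::finite cmat"
  by (simp add: matrix_matrix_mult_def vec_eq_iff sum.distrib algebra_simps)

lemma matrix_mult_sum_left: "(\<Sum>i\<in>I. f i) ** B = (\<Sum>i\<in>I. f i ** B)"
  for B :: "'m::finite cmat" and f :: "_ \<Rightarrow> 'm cmat"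
  by (induction I rule: infinite_finite_induct) (simp_all add: matrix_add_rdistrib)

lemma matrix_mult_sum_right: "A ** (\<Sum>i\<in>I. f i) = (\<Sum>i\<in>I. A ** f i)"
  for A :: "'m::finite cmat" and f :: "_ \<Rightarrow> 'm cmat"
  by (induction I rule: infinite_finite_induct) (simp_all add: matrix_add_ldistrib)

lemmas mat_ring_simps = matrix_mul_assoc[symmetric] matrix_add_ldistrib matrix_add_rdistrib
  matrix_diff_distrib matrix_mult_uminus mscale_mult_left mscale_mult_right mscale_distrib
  mat_mult_eq_mscale

lemma matrix_inv_mult:
  assumes "invertible (A :: 'm::finite cmat)"
  shows "matrix_inv A ** A = mat 1" "A ** matrix_inv A = mat 1"
  using someI_ex[OF assms[unfolded invertible_def]] by (simp_all add: matrix_inv_def)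

lemma matrix_inv_cancel:
  assumes "invertible (A :: 'm::finite cmat)"
  shows "matrix_inv A ** (A ** B) = B" "A ** (matrix_inv A ** B) = B"
  by (simp_all add: matrix_mul_assoc matrix_inv_mult[OF assms])

lemma invertible_mult_left_cancel:
  assumes "invertible (A :: 'm::finite cmat)" "A ** B = A ** C"
  shows "B = C"
  using assms by (metis matrix_inv_cancel(1))

lemma invertible_mult_right_cancel:
  assumes "invertible (A :: 'm::finite cmat)" "B ** A = C ** A"
  shows "B = C"
  using assms by (metis matrix_inv_mult(2) matrix_mul_assoc matrix_mul_rid)

lemma invertible_mscale:
  assumes "invertible (A :: 'm::finite cmat)" "c \<noteq> 0"
  shows "invertible (mscale c A)"
  unfolding invertible_def
  by (rule exI[of _ "mscale (inverse c) (matrix_inv A)"])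
    (use assms in \<open>simp add: mat_ring_simps matrix_inv_mult\<close>)

lemma invertible_mat_1: "invertible (mat 1 :: 'm::finite cmat)"
  unfolding invertible_def by (rule exI[of _ "mat 1"]) simp

lemma invertible_uminus: "invertible (A :: 'm::finite cmat) \<Longrightarrow> invertible (- A)"
  using invertible_mscale[of A "-1"] by (simp add: mscale_distrib)

lemma not_invertible_kernel:
  assumes "\<not> invertible (A :: 'm::finite cmat)"
  obtains w where "w \<noteq> 0" "A *v w = 0"
  using assms by (metis invertible_left_inverse matrix_left_invertible_ker)

lemma invertible_kernel: "invertible (A :: 'm::finite cmat) \<Longrightarrow> A *v w = 0 \<Longrightarrow> w = 0"
  by (metis invertible_left_inverse matrix_left_invertible_ker)

lemma real_scaleR_eq_mscale: "real n *\<^sub>R A = mscale (of_nat n) A" for A :: "'m::finite cmat"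
  by (simp add: mscale_def vec_eq_iff scaleR_conv_of_real[of _ "A $ _ $ _"])

lemma mscale_mult_vector: "mscale c A *v w = A *v (mat c *v w)" for A :: "'m::finite cmat"
  by (simp add: matrix_vector_mul_assoc mat_mult_eq_mscale)

lemma matrix_vector_mult_uminus: "(- A) *v w = - (A *v w)" "A *v (- w) = - (A *v w)"
  for A :: "'m::finite cmat"
  by (simp_all add: matrix_vector_mult_def vec_eq_iff sum_negf)

lemmas matrix_vector_simps = matrix_vector_mul_assoc[symmetric] matrix_vector_mult_add_rdistrib
  matrix_vector_mult_diff_rdistrib matrix_vector_right_distrib matrix_vector_mult_diff_distrib
  matrix_vector_mult_uminus mscale_mult_vector

subsection \<open>Matrix polynomials\<close>

lemma coeff_const_mp_mult: "coeff ([:A:] \<odot> P) n = A ** coeff P n" for P :: "'m::finite cmat poly"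
proof -
  have "coeff ([:A:] \<odot> P) n = (\<Sum>i\<le>n. if i = 0 then A ** coeff P n else 0)"
    unfolding coeff_mp_mult by (rule sum.cong) (auto simp: coeff_pCons split: nat.splits)
  then show ?thesis by simp
qed

lemma mp_mult_assoc: "P \<odot> Q \<odot> R = P \<odot> (Q \<odot> R)" for P Q R :: "'m::finite cmat poly"
proof (rule poly_eqI)
  fix n
  \<comment> \<open>Exchanging the order of summation uses addition only, so this lemma on power
    series applies to the noncommutative \<open>**\<close>.\<close>
  have "(\<Sum>j=0..n. \<Sum>i=0..j. coeff P i ** coeff Q (j - i) ** coeff R (n - j)) =
      (\<Sum>j=0..n. \<Sum>i=0..n - j. coeff P j ** coeff Q i ** coeff R (n - j - i))"
    by (rule fps_mult_assoc_lemma)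
  then show "coeff (P \<odot> Q \<odot> R) n = coeff (P \<odot> (Q \<odot> R)) n"
    by (simp add: coeff_mp_mult matrix_mult_sum_left matrix_mult_sum_right matrix_mul_assoc
        atMost_atLeast0)
qed

lemma mp_mult_distrib:
  fixes P Q R :: "'m::finite cmat poly"
  shows "P \<odot> (Q + R) = P \<odot> Q + P \<odot> R" "(P + Q) \<odot> R = P \<odot> R + Q \<odot> R"
    "P \<odot> (Q - R) = P \<odot> Q - P \<odot> R" "(P - Q) \<odot> R = P \<odot> R - Q \<odot> R"
    "P \<odot> (- Q) = - (P \<odot> Q)" "(- P) \<odot> Q = - (P \<odot> Q)"
  by (simp_all add: poly_eq_iff coeff_mp_mult mat_ring_simps sum.distrib sum_subtractf sum_negf)

lemma mp_mult_zero [simp]: "P \<odot> 0 = 0" "0 \<odot> P = 0" for P :: "'m::finite cmat poly"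
  by (simp_all add: poly_eq_iff coeff_mp_mult)

lemma mp_mult_one [simp]: "[:mat 1:] \<odot> P = P" for P :: "'m::finite cmat poly"
  by (simp add: poly_eq_iff coeff_const_mp_mult)

lemma const_mp_mult_const [simp]: "[:A:] \<odot> [:B:] = [:A ** B:]" for A B :: "'m::finite cmat"
  by (simp add: poly_eq_iff coeff_const_mp_mult coeff_pCons split: nat.splits)

lemma const_const_mp_mult: "[:A:] \<odot> ([:B:] \<odot> P) = [:A ** B:] \<odot> P"
  for A B :: "'m::finite cmat"
  by (simp flip: mp_mult_assoc)

lemma scalar_mp_commute: "scalar_mp a \<odot> P = P \<odot> scalar_mp a" for P :: "'m::finite cmat poly"
proof (rule poly_eqI)
  fix n
  show "coeff (scalar_mp a \<odot> P) n = coeff (P \<odot> scalar_mp a) n"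
    unfolding coeff_mp_mult coeff_scalar_mp
    by (rule sum.reindex_bij_witness[of _ "\<lambda>i. n - i" "\<lambda>i. n - i"]) (auto simp: mat_commute)
qed

lemma scalar_mp_left_commute: "P \<odot> (scalar_mp a \<odot> Q) = scalar_mp a \<odot> (P \<odot> Q)"
  for P Q :: "'m::finite cmat poly"
  by (metis mp_mult_assoc scalar_mp_commute)

lemma mat_sum: "mat (\<Sum>i\<in>I. f i) = (\<Sum>i\<in>I. mat (f i) :: 'm::finite cmat)"
  by (induction I rule: infinite_finite_induct) (simp_all add: mat_add)

lemma scalar_mp_mult: "scalar_mp (a * b) = scalar_mp a \<odot> (scalar_mp b :: 'm::finite cmat poly)"
  by (simp add: poly_eq_iff coeff_mp_mult coeff_mult mat_sum coeff_scalar_mp mat_mult_eq_mscale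
      mat_eq_mscale[of "coeff _ _ * _"] mat_eq_mscale[of "coeff _ _"] mscale_mult_left)

lemma scalar_scalar_mp_mult: "scalar_mp a \<odot> (scalar_mp b \<odot> P) = scalar_mp (a * b) \<odot> P"
  for P :: "'m::finite cmat poly"
  by (simp add: scalar_mp_mult mp_mult_assoc)

lemma scalar_mp_add: "scalar_mp (a + b) = scalar_mp a + (scalar_mp b :: 'm::finite cmat poly)"
  by (simp add: poly_eq_iff coeff_scalar_mp mat_add)

lemma scalar_mp_const: "scalar_mp [:c:] = [:mat c:]"
  by (simp add: poly_eq_iff coeff_scalar_mp coeff_pCons split: nat.splits)

lemma scalar_mp_monom: "scalar_mp (monom 1 k) = mp_X k"
  by (simp add: poly_eq_iff coeff_scalar_mp)

lemma scalar_mp_0 [simp]: "scalar_mp 0 = 0"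
  by (simp add: poly_eq_iff coeff_scalar_mp)

lemma mp_deriv_add: "mp_deriv (P + Q) = mp_deriv P + mp_deriv Q"
  by (simp add: poly_eq_iff coeff_mp_deriv algebra_simps)

lemma mp_deriv_diff: "mp_deriv (P - Q) = mp_deriv P - mp_deriv Q"
  by (simp add: poly_eq_iff coeff_mp_deriv algebra_simps)

lemma mp_deriv_const_mult: "mp_deriv ([:A:] \<odot> P) = [:A:] \<odot> mp_deriv P"
  by (simp add: poly_eq_iff coeff_mp_deriv coeff_const_mp_mult real_scaleR_eq_mscale
      mscale_mult_right del: of_nat_Suc)

lemma mp_deriv_mult: "mp_deriv (P \<odot> Q) = mp_deriv P \<odot> Q + P \<odot> mp_deriv Q"
  for P Q :: "'m::finite cmat poly"
proof (rule poly_eqI)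
  fix n
  let ?f = "\<lambda>i. coeff P i ** coeff Q (Suc n - i)"
  have "coeff (mp_deriv (P \<odot> Q)) n = (\<Sum>i\<le>Suc n. mscale (of_nat (Suc n)) (?f i))"
    unfolding coeff_mp_deriv coeff_mp_mult real_scaleR_eq_mscale
    by (simp only: mat_mult_eq_mscale(1)[symmetric] matrix_mult_sum_right)
  \<comment> \<open>The factor n + 1 splits as i + (n + 1 - i): the first summand differentiates
    \<open>P\<close>, the second \<open>Q\<close>.\<close>
  also have "\<dots> = (\<Sum>i\<le>Suc n. mscale (of_nat i) (?f i)) +
      (\<Sum>i\<le>Suc n. mscale (of_nat (Suc n - i)) (?f i))"
    unfolding sum.distrib[symmetric]
    by (rule sum.cong) (auto simp: of_nat_diff mscale_distrib simp del: of_nat_Suc)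
  also have "(\<Sum>i\<le>Suc n. mscale (of_nat i) (?f i)) =
      (\<Sum>i\<le>n. mscale (of_nat (Suc i)) (?f (Suc i)))"
    by (subst sum.atMost_Suc_shift) simp
  also have "\<dots> = coeff (mp_deriv P \<odot> Q) n"
    by (simp add: coeff_mp_mult coeff_mp_deriv real_scaleR_eq_mscale mscale_mult_left del: of_nat_Suc)
  also have "(\<Sum>i\<le>Suc n. mscale (of_nat (Suc n - i)) (?f i)) = coeff (P \<odot> mp_deriv Q) n"
    by (simp add: coeff_mp_mult coeff_mp_deriv real_scaleR_eq_mscale mscale_mult_right Suc_diff_le
        del: of_nat_Suc of_nat_diff)
  finally show "coeff (mp_deriv (P \<odot> Q)) n = coeff (mp_deriv P \<odot> Q + P \<odot> mp_deriv Q) n"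
    by simp
qed

lemma mp_deriv_scalar_mp: "mp_deriv (scalar_mp a) = (scalar_mp (pderiv a) :: 'm::finite cmat poly)"
  by (simp add: poly_eq_iff coeff_mp_deriv coeff_scalar_mp coeff_pderiv real_scaleR_eq_mscale
      mat_eq_mscale[of "of_nat _ * _"] mat_eq_mscale[of "coeff _ _"] del: of_nat_Suc)

lemma mp_deriv_scalar_mult:
  "mp_deriv (scalar_mp a \<odot> P) = scalar_mp (pderiv a) \<odot> P + scalar_mp a \<odot> mp_deriv P"
  for P :: "'m::finite cmat poly"
  by (simp add: mp_deriv_mult mp_deriv_scalar_mp)

lemma degree_mp_deriv_le: "degree (mp_deriv P) \<le> degree P - 1"
  by (rule degree_le) (auto simp: coeff_mp_deriv coeff_eq_0)

lemma mp_deriv_eq_0D: "mp_deriv P = 0 \<Longrightarrow> P = [:coeff P 0:]"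
proof (rule poly_eqI)
  fix n assume "mp_deriv P = 0"
  then have "coeff (mp_deriv P) k = 0" for k by simp
  then have "coeff P (Suc k) = 0" for k unfolding coeff_mp_deriv by (simp del: of_nat_Suc)
  then show "coeff P n = coeff [:coeff P 0:] n"
    by (simp add: coeff_pCons split: nat.splits)
qed

subsection \<open>Matrix functionals\<close>

lemma mp_mult_sum_left: "(\<Sum>i\<in>I. f i) \<odot> R = (\<Sum>i\<in>I. f i \<odot> R)"
  for R :: "'m::finite cmat poly"
  by (induction I rule: infinite_finite_induct) (simp_all add: mp_mult_distrib)

lemma scalar_mp_as_sum:
  assumes "degree a \<le> n"
  shows "scalar_mp a = (\<Sum>k\<le>n. [:mat (coeff a k):] \<odot> (mp_X k :: 'm::finite cmat poly))"
proof (rule poly_eqI)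
  fix i
  have "coeff (\<Sum>k\<le>n. [:mat (coeff a k):] \<odot> mp_X k) i =
      (\<Sum>k\<le>n. if k = i then mat (coeff a i) else (0 :: 'm cmat))"
    unfolding coeff_sum by (rule sum.cong) (auto simp: coeff_const_mp_mult)
  also have "\<dots> = mat (coeff a i)"
    using assms by (auto simp: coeff_eq_0)
  finally show "coeff (scalar_mp a) i =
      coeff (\<Sum>k\<le>n. [:mat (coeff a k):] \<odot> (mp_X k :: 'm cmat poly)) i"
    by (simp add: coeff_scalar_mp)
qed

lemma fun_mult_eq_sum:
  assumes "degree Q \<le> n"
  shows "fun_mult u Q S = (\<Sum>k\<le>n. u (mp_X k \<odot> S) ** coeff Q k)"
  unfolding fun_mult_def
  by (rule sum.mono_neutral_left) (use assms in \<open>auto simp: coeff_eq_0\<close>)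

lemma fun_mult_add: "fun_mult u (Q + R) S = fun_mult u Q S + fun_mult u R S"
proof -
  let ?n = "max (degree Q) (degree R)"
  have "degree (Q + R) \<le> ?n" by (rule degree_add_le_max)
  then show ?thesis
    by (simp add: fun_mult_eq_sum[where n = ?n] matrix_add_ldistrib sum.distrib)
qed

context
  fixes u :: "'m::finite functional"
  assumes lin: "left_linear u"
begin

lemma functional_add: "u (S + T) = u S + u T"
  using lin unfolding left_linear_def by blast

lemma functional_const_mult: "u ([:A:] \<odot> S) = A ** u S"
  using lin unfolding left_linear_def by blast

lemma functional_zero: "u 0 = 0"
  using functional_add[of 0 0] by simp

lemma functional_diff: "u (S - T) = u S - u T"
  using functional_add[of "S - T" T] by simp

lemma functional_sum: "u (\<Sum>i\<in>I. f i) = (\<Sum>i\<in>I. u (f i))"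
  by (induction I rule: infinite_finite_induct) (simp_all add: functional_add functional_zero)

lemma functional_scalar_eq_sum:
  assumes "degree a \<le> n"
  shows "u (scalar_mp a \<odot> S) = (\<Sum>k\<le>n. mscale (coeff a k) (u (mp_X k \<odot> S)))"
  by (simp add: scalar_mp_as_sum[OF assms] mp_mult_sum_left functional_sum mp_mult_assoc
      functional_const_mult mat_mult_eq_mscale)

lemma fun_mult_scalar: "fun_mult u (scalar_mp a) S = u (scalar_mp a \<odot> S)"
proof -
  have "degree (scalar_mp a :: 'm cmat poly) \<le> degree a"
    by (rule degree_le) (simp add: coeff_scalar_mp coeff_eq_0)
  then show ?thesis
    by (simp add: fun_mult_eq_sum functional_scalar_eq_sum[OF order_refl] coeff_scalar_mp
        mat_mult_eq_mscale)
qed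

lemma functional_scalar_add: "u (scalar_mp (a + b) \<odot> S) = u (scalar_mp a \<odot> S) + u (scalar_mp b \<odot> S)"
  by (simp add: scalar_mp_add mp_mult_distrib functional_add)

lemma functional_scalar_smult: "u (scalar_mp (smult c a) \<odot> S) = mscale c (u (scalar_mp a \<odot> S))"
proof -
  have "scalar_mp (smult c a) = [:mat c:] \<odot> (scalar_mp a :: 'm cmat poly)"
    using scalar_mp_mult[of "[:c:]" a] by (simp add: scalar_mp_const)
  then show ?thesis
    by (simp add: mp_mult_assoc functional_const_mult mat_mult_eq_mscale)
qed

lemma functional_linear_scalar:
  assumes "degree a \<le> 1"
  shows "u (scalar_mp a \<odot> S) = mscale (coeff a 0) (u S) + mscale (coeff a 1) (u (mp_X 1 \<odot> S))"
  using functional_scalar_eq_sum[OF assms, of S] by (simp add: monom_0)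

end

definition orthogonal_below :: "'m::finite functional \<Rightarrow> nat \<Rightarrow> 'm cmat poly \<Rightarrow> bool" where
  "orthogonal_below u n S \<longleftrightarrow> (\<forall>k<n. u (mp_X k \<odot> S) = 0)"

lemma functional_orthogonal:
  assumes "left_linear u" "orthogonal_below u n S" "degree a \<le> n"
  shows "u (scalar_mp a \<odot> S) = mscale (coeff a n) (u (mp_X n \<odot> S))"
proof -
  have "u (scalar_mp a \<odot> S) = (\<Sum>k\<le>n. if k = n then mscale (coeff a n) (u (mp_X n \<odot> S)) else 0)"
    unfolding functional_scalar_eq_sum[OF assms(1,3)]
    by (rule sum.cong) (use assms(2) in \<open>auto simp: orthogonal_below_def\<close>)
  then show ?thesis by simp
qed

text \<open>Coefficientwise integration. It lets \<open>invertible_M\<close> pass from all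
  derivatives to all polynomials.\<close>

lemma mp_deriv_surj: "\<exists>S. mp_deriv S = T"
proof
  let ?S = "\<Sum>i\<le>degree T. monom (mscale (1 / of_nat (Suc i)) (coeff T i)) (Suc i)"
  show "mp_deriv ?S = T"
  proof (rule poly_eqI)
    fix n
    have "coeff ?S (Suc n) = (\<Sum>i\<le>degree T. if i = n then mscale (1 / of_nat (Suc n)) (coeff T n) else 0)"
      unfolding coeff_sum by (rule sum.cong) auto
    also have "\<dots> = mscale (1 / of_nat (Suc n)) (coeff T n)"
      by (auto simp: coeff_eq_0)
    finally show "coeff (mp_deriv ?S) n = coeff T n"
      by (simp add: coeff_mp_deriv real_scaleR_eq_mscale del: of_nat_Suc)
  qed
qed

section \<open>The matrices M_n and their products V_n\<close>

lemma M_mat_shift: "M_mat a (b + mat (2 * a)) k = M_mat a b (k + 2)"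
  by (simp add: M_mat_def add.assoc flip: mat_add) (simp add: algebra_simps)

lemma M_mat_commute:
  fixes A :: "'m::finite cmat"
  assumes "A ** b = b ** A"
  shows "A ** M_mat a b k = M_mat a b k ** A"
  using assms by (simp add: M_mat_def mat_ring_simps)

text \<open>Every factor is \<open>b\<close> plus a scalar matrix. Arbitrary index lists make the
  induction possible.\<close>

lemma foldr_M_mat_commute:
  fixes b :: "'m::finite cmat"
  shows "foldr (\<lambda>k A. M_mat a b k ** A) ks (mat 1) ** b = b ** foldr (\<lambda>k A. M_mat a b k ** A) ks (mat 1)"
proof (induction ks)
  case (Cons k ks)
  have "b ** M_mat a b k = M_mat a b k ** b" by (rule M_mat_commute) simp
  with Cons show ?case by (simp flip: matrix_mul_assoc) (simp add: matrix_mul_assoc)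
qed simp

lemma V_mat_commute: "V_mat a b n ** b = b ** V_mat a b n"
  unfolding V_mat_def by (rule foldr_M_mat_commute)

lemma invertible_V_mat:
  fixes b :: "'m::finite cmat"
  assumes "\<And>k. invertible (M_mat a b k)"
  shows "invertible (V_mat a b n)"
proof -
  have "invertible (foldr (\<lambda>k A. M_mat a b k ** A) ks (mat 1))" for ks
    by (induction ks) (auto intro: invertible_mult assms invertible_mat_1)
  then show ?thesis unfolding V_mat_def .
qed

lemma V_mat_0: "V_mat a b 0 = M_mat a b 0 ** M_mat a b 1"
  by (simp add: V_mat_def numeral_2_eq_2)

text \<open>The indices n + 1, ..., 2n + 3 are n + 1 followed by n, ..., 2n + 1 raised by 2. Passing
  from u to u \<alpha> adds 2 \<open>\<alpha>\<^sub>2\<close> I to the linear coefficient of \<Psi>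
  and so raises every index by 2.\<close>

lemma V_mat_Suc: "V_mat a b (Suc n) = M_mat a b (Suc n) ** V_mat a (b + mat (2 * a)) n"
proof -
  have "[Suc n..<2 * Suc n + 2] = Suc n # map (\<lambda>k. k + 2) [n..<2 * n + 2]"
    by (subst upt_conv_Cons) (auto intro!: nth_equalityI simp del: upt_Suc)
  then show ?thesis
    by (simp only: V_mat_def foldr_map foldr.simps o_def M_mat_shift)
qed

subsection \<open>Functionals with a Pearson equation\<close>

text \<open>The induction replaces \<open>u\<close>, \<open>\<Psi>\<close> and \<open>P\<close>
  together, and \<open>shift\<close> supplies the new instance. Quasi-definiteness enters as a monic
  orthogonal sequence, a form that can be constructed explicitly for u \<alpha>.\<close>

locale pearson_MOP =
  fixes u :: "'m::finite functional" and \<alpha> :: "complex poly" and \<Psi> :: "'m cmat poly"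
    and P :: "nat \<Rightarrow> 'm cmat poly"
  assumes left_linear: "left_linear u"
    and alpha_nonzero: "\<alpha> \<noteq> 0" and degree_alpha: "degree \<alpha> \<le> 2" and degree_Psi: "degree \<Psi> \<le> 1"
    and pearson: "pearson u \<alpha> \<Psi>"
    and monic_MOP: "monic_MOP u P"
begin

abbreviation "M \<equiv> M_mat (coeff \<alpha> 2) (coeff \<Psi> 1)"

lemma alpha_eq: "\<alpha> = [:coeff \<alpha> 0, coeff \<alpha> 1, coeff \<alpha> 2:]"
  using degree_alpha
  by (auto simp: poly_eq_iff coeff_pCons coeff_eq_0 numeral_2_eq_2 split: nat.splits)

lemma degree_P: "degree (P n) = n" and coeff_P: "coeff (P n) n = mat 1"
  and invertible_E: "invertible (u (mp_X n \<odot> P n))" and P_orthogonal: "orthogonal_below u n (P n)"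
  using monic_MOP unfolding monic_MOP_def MOP_def orthogonal_below_def by auto

lemma P_0: "P 0 = [:mat 1:]"
  using degree_P[of 0] coeff_P[of 0] by (metis coeff_pCons_0 degree_eq_zeroE)

lemma invertible_moment_0: "invertible (u [:mat 1:])"
  using invertible_E[of 0] by (simp add: P_0 monom_0)

section \<open>Pairing derivatives with u \<alpha>\<close>

lemma pearson_deriv:
  "u (scalar_mp \<alpha> \<odot> mp_deriv S) = - (u S ** coeff \<Psi> 0 + u (mp_X 1 \<odot> S) ** coeff \<Psi> 1)"
proof -
  have "- u (scalar_mp \<alpha> \<odot> mp_deriv S) = fun_mult u \<Psi> S"
    using fun_cong[OF pearson[unfolded pearson_def], of S]
    by (simp add: fun_deriv_def fun_mult_scalar[OF left_linear])
  also have "\<dots> = u S ** coeff \<Psi> 0 + u (mp_X 1 \<odot> S) ** coeff \<Psi> 1"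
    by (simp add: fun_mult_eq_sum[OF degree_Psi] monom_0)
  finally show ?thesis by (metis minus_minus)
qed

text \<open>The Pearson equation is applied to a S; the product rule then isolates the term with
  S'.\<close>

lemma pearson_scalar_mult_deriv:
  "u (scalar_mp \<alpha> \<odot> (scalar_mp a \<odot> mp_deriv S)) =
    - (u (scalar_mp a \<odot> S) ** coeff \<Psi> 0 + u (scalar_mp (monom 1 1 * a) \<odot> S) ** coeff \<Psi> 1)
    - u (scalar_mp (\<alpha> * pderiv a) \<odot> S)"
  using pearson_deriv[of "scalar_mp a \<odot> S"]
  by (simp add: mp_deriv_scalar_mult mp_mult_distrib functional_add[OF left_linear]
      scalar_scalar_mp_mult scalar_mp_monom[symmetric] algebra_simps)

text \<open>Taking a = x^k in \<open>pearson_scalar_mult_deriv\<close> leaves pairings of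
  \<open>S\<close> with polynomials of degree at most k + 1. They vanish for k < n. For k = n only
  the coefficients of x^(n+1) count: \<open>\<psi>\<^sub>1\<close> comes from x a, and n
  \<open>\<alpha>\<^sub>2\<close> from \<alpha> a'.\<close>

lemma deriv_orthogonal:
  assumes "orthogonal_below u (Suc n) S"
  shows "orthogonal_below (\<lambda>S. u (scalar_mp \<alpha> \<odot> S)) n (mp_deriv S)"
    and "u (scalar_mp \<alpha> \<odot> (mp_X n \<odot> mp_deriv S)) = - (u (mp_X (Suc n) \<odot> S) ** M n)"
proof -
  let ?E = "u (mp_X (Suc n) \<odot> S)"
  have key: "u (scalar_mp \<alpha> \<odot> (mp_X k \<odot> mp_deriv S)) = (if k = n then - (?E ** M n) else 0)"
    if "k \<le> n" for k
  proof -
    have "degree (\<alpha> * pderiv (monom 1 k)) \<le> Suc k"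
    proof (cases "k = 0")
      case False
      have "degree (\<alpha> * pderiv (monom 1 k)) \<le> degree \<alpha> + degree (pderiv (monom 1 k :: complex poly))"
        by (rule degree_mult_le)
      also have "\<dots> \<le> 2 + (k - 1)"
        by (intro add_mono degree_alpha) (simp add: degree_pderiv degree_monom_eq)
      finally show ?thesis using False by simp
    qed (simp add: monom_0)
    then have "u (scalar_mp (\<alpha> * pderiv (monom 1 k)) \<odot> S) =
        mscale (coeff (\<alpha> * pderiv (monom 1 k)) (Suc n)) ?E"
      using that by (intro functional_orthogonal[OF left_linear assms]) simp
    moreover have "coeff (\<alpha> * pderiv (monom 1 k)) (Suc n) =
        (if k = n then of_nat n * coeff \<alpha> 2 else 0)"
    proof (cases k)
      case (Suc j)
      then have "coeff (\<alpha> * pderiv (monom 1 k)) (Suc n) = of_nat k * coeff \<alpha> (Suc n - j)"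
        using that by (simp add: pderiv_monom coeff_monom_mult mult.commute[of \<alpha>] del: of_nat_Suc)
      \<comment> \<open>With j = k - 1 the index is n + 2 - k, which is 2 for k = n and larger
        otherwise.\<close>
      moreover have "coeff \<alpha> (Suc n - j) = 0" if "k \<noteq> n"
        using that \<open>k \<le> n\<close> Suc degree_alpha by (intro coeff_eq_0) linarith
      ultimately show ?thesis using Suc by (auto simp: numeral_2_eq_2)
    qed (simp add: monom_0)
    moreover have "u (scalar_mp (monom 1 k) \<odot> S) = 0"
      using that assms by (simp add: scalar_mp_monom orthogonal_below_def)
    moreover have "u (scalar_mp (monom 1 1 * monom 1 k) \<odot> S) = (if k = n then ?E else 0)"
      using that assms by (simp add: scalar_mp_monom orthogonal_below_def mult_monom)
    ultimately show ?thesis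
      using pearson_scalar_mult_deriv[of "monom 1 k" S]
      by (auto simp: scalar_mp_monom M_mat_def mat_ring_simps)
  qed
  show "orthogonal_below (\<lambda>S. u (scalar_mp \<alpha> \<odot> S)) n (mp_deriv S)"
    unfolding orthogonal_below_def by (simp add: key)
  show "u (scalar_mp \<alpha> \<odot> (mp_X n \<odot> mp_deriv S)) = - (?E ** M n)"
    by (simp add: key)
qed

section \<open>Invertibility of the matrices M_r\<close>

lemma pearson_monom_deriv:
  "u (scalar_mp \<alpha> \<odot> (mp_X j \<odot> mp_deriv S)) =
    - (u (mp_X j \<odot> S) ** (coeff \<Psi> 0 + mat (of_nat j * coeff \<alpha> 1)) + u (mp_X (Suc j) \<odot> S) ** M j
      + mscale (coeff \<alpha> 0) (u (scalar_mp (pderiv (monom 1 j)) \<odot> S)))"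
proof -
  have "\<alpha> = monom (coeff \<alpha> 0) 0 + monom (coeff \<alpha> 1) 1 + monom (coeff \<alpha> 2) 2"
    by (subst alpha_eq) (simp add: monom_altdef numeral_2_eq_2)
  then have "\<alpha> * pderiv (monom 1 j) = (monom (coeff \<alpha> 0) 0 + monom (coeff \<alpha> 1) 1 +
      monom (coeff \<alpha> 2) 2) * pderiv (monom 1 j)" by simp
  \<comment> \<open>The \<open>\<alpha>\<^sub>0\<close> term keeps the derivative of x^j, so that
    the formula has no truncated exponent at j = 0. The x^(j+1) term completes
    \<open>\<psi>\<^sub>1\<close> to \<open>M j\<close>.\<close>
  also have "\<dots> = smult (coeff \<alpha> 0) (pderiv (monom 1 j)) +
      smult (of_nat j * coeff \<alpha> 1) (monom 1 j) + smult (of_nat j * coeff \<alpha> 2) (monom 1 (Suc j))"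
    by (cases j) (simp_all add: pderiv_monom mult_monom smult_monom distrib_right distrib_left mult.commute
        del: of_nat_Suc)
  finally have "u (scalar_mp (\<alpha> * pderiv (monom 1 j)) \<odot> S) =
      mscale (coeff \<alpha> 0) (u (scalar_mp (pderiv (monom 1 j)) \<odot> S)) +
      mscale (of_nat j * coeff \<alpha> 1) (u (mp_X j \<odot> S)) +
      mscale (of_nat j * coeff \<alpha> 2) (u (mp_X (Suc j) \<odot> S))"
    by (simp only: functional_scalar_add[OF left_linear] functional_scalar_smult[OF left_linear]
        scalar_mp_monom)
  then show ?thesis
    using pearson_scalar_mult_deriv[of "monom 1 j" S]
    by (simp add: scalar_mp_monom mult_monom M_mat_def mat_ring_simps algebra_simps)
qed

text \<open>Test with \<open>P n\<close> for n = deg \<alpha> + r. The polynomial \<alpha> x^j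
  reaches degree n only for j = r, so orthogonality leaves the leading coefficient of \<alpha> times
  E_n c_r, and E_n is invertible.\<close>

lemma alpha_monom_kernel:
  assumes "\<And>T. (\<Sum>j\<le>r. u (scalar_mp \<alpha> \<odot> (mp_X j \<odot> T)) *v c j) = 0"
  shows "c r = 0"
proof -
  let ?n = "degree \<alpha> + r"
  have eq: "u (scalar_mp \<alpha> \<odot> (mp_X j \<odot> P ?n)) =
      (if j = r then mscale (lead_coeff \<alpha>) (u (mp_X ?n \<odot> P ?n)) else 0)" if "j \<le> r" for j
  proof -
    have "degree (\<alpha> * monom 1 j) \<le> ?n"
      using that by (intro order_trans[OF degree_mult_le]) (simp add: degree_monom_eq)
    then have "u (scalar_mp (\<alpha> * monom 1 j) \<odot> P ?n) =
        mscale (coeff (\<alpha> * monom 1 j) ?n) (u (mp_X ?n \<odot> P ?n))"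
      by (intro functional_orthogonal[OF left_linear P_orthogonal])
    moreover have "coeff (\<alpha> * monom 1 j) ?n = (if j = r then lead_coeff \<alpha> else 0)"
      using that by (auto simp: coeff_monom_mult mult.commute[of \<alpha>] coeff_eq_0)
    ultimately show ?thesis
      by (simp add: scalar_scalar_mp_mult flip: scalar_mp_monom)
  qed
  have "0 = (\<Sum>j\<le>r. u (scalar_mp \<alpha> \<odot> (mp_X j \<odot> P ?n)) *v c j)"
    by (simp add: assms)
  also have "\<dots> = (\<Sum>j\<le>r. if j = r then mscale (lead_coeff \<alpha>) (u (mp_X ?n \<odot> P ?n)) *v c r else 0)"
    by (rule sum.cong) (auto simp: eq)
  also have "\<dots> = mscale (lead_coeff \<alpha>) (u (mp_X ?n \<odot> P ?n)) *v c r"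
    by simp
  finally show ?thesis
    using invertible_kernel[OF invertible_mscale[OF invertible_E[of ?n]], of "lead_coeff \<alpha>" "c r"]
      alpha_nonzero by simp
qed

text \<open>If \<open>w \<noteq> 0\<close> is in the kernel of \<open>M r\<close> and \<open>M j\<close> is invertible for \<open>j < r\<close>, then there is a
  right vector polynomial \<open>R\<close> of degree \<open>r\<close> with leading coefficient \<open>w\<close> and
  \<open>\<alpha> R' + \<Psi> R\<close> constant; pairing with \<open>1\<close> shows that the constant vanishes.
  So \<open>D (u \<alpha> R) = 0\<close>, hence \<open>u \<alpha> R = 0\<close>, against quasi-definiteness.\<close>

lemma invertible_M: "invertible (M r)"
proof (induction r rule: less_induct)
  case (less r)
  show ?case
  proof (rule ccontr)
    assume "\<not> invertible (M r)"
    then obtain w where w: "w \<noteq> 0" "M r *v w = 0" by (rule not_invertible_kernel)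
    let ?u1 = "\<lambda>j S. u (scalar_mp \<alpha> \<odot> (mp_X j \<odot> mp_deriv S))"
    \<comment> \<open>The coefficients of \<open>R\<close> are chosen downwards from x^r. Once those
      from x^i on are fixed, the pairings with higher powers have cancelled, and the remainder
      involves only x^i and its derivative.\<close>
    have "\<exists>c A B. c r = w \<and> (\<forall>S. (\<Sum>j=i..r. ?u1 j S *v c j) =
        u (mp_X i \<odot> S) *v A + u (scalar_mp (pderiv (monom 1 i)) \<odot> S) *v B)" if "i \<le> r" for i
      using that
    proof (induction i rule: inc_induct)
      case base
      have "?u1 r S *v w = u (mp_X r \<odot> S) *v (- ((coeff \<Psi> 0 + mat (of_nat r * coeff \<alpha> 1)) *v w)) +
          u (scalar_mp (pderiv (monom 1 r)) \<odot> S) *v (- (mat (coeff \<alpha> 0) *v w))" for S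
        using w unfolding pearson_monom_deriv
        by (simp add: matrix_vector_simps)
      then show ?case
        by (intro exI[of _ "\<lambda>_. w"]) auto
    next
      case (step i)
      then obtain c A B where c: "c r = w" and cAB: "\<And>S. (\<Sum>j=Suc i..r. ?u1 j S *v c j) =
        u (mp_X (Suc i) \<odot> S) *v A + u (scalar_mp (pderiv (monom 1 (Suc i))) \<odot> S) *v B"
        by blast
      \<comment> \<open>With this coefficient the term with \<open>M i\<close> in
        \<open>pearson_monom_deriv\<close> cancels the remainder \<open>A\<close> at
        x^(i+1).\<close>
      define v where "v = matrix_inv (M i) *v A"
      have v: "M i *v v = A"
        using less.IH[OF step.hyps(2)] by (simp add: v_def matrix_vector_mul_assoc matrix_inv_mult)
      have deriv: "u (scalar_mp (pderiv (monom 1 (Suc i))) \<odot> S) = mscale (of_nat (Suc i)) (u (mp_X i \<odot> S))" for S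
        using functional_scalar_smult[OF left_linear, of "of_nat (Suc i)" "monom 1 i" S]
        by (simp add: pderiv_monom smult_monom scalar_mp_monom del: of_nat_Suc)
      have "(\<Sum>j=i..r. ?u1 j S *v (c(i := v)) j) =
        u (mp_X i \<odot> S) *v (mat (of_nat (Suc i)) *v B - (coeff \<Psi> 0 + mat (of_nat i * coeff \<alpha> 1)) *v v) +
        u (scalar_mp (pderiv (monom 1 i)) \<odot> S) *v (- (mat (coeff \<alpha> 0) *v v))" for S
      proof -
        have "(\<Sum>j=i..r. ?u1 j S *v (c(i := v)) j) = ?u1 i S *v v + (\<Sum>j=Suc i..r. ?u1 j S *v c j)"
          using step.hyps by (subst sum.atLeast_Suc_atMost) (auto intro!: sum.cong)
        also have "\<dots> = u (mp_X i \<odot> S) *v (mat (of_nat (Suc i)) *v B - (coeff \<Psi> 0 + mat (of_nat i * coeff \<alpha> 1)) *v v) +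
          u (scalar_mp (pderiv (monom 1 i)) \<odot> S) *v (- (mat (coeff \<alpha> 0) *v v))"
          unfolding cAB deriv pearson_monom_deriv[of i S]
          by (simp add: matrix_vector_simps v del: of_nat_Suc One_nat_def)
        finally show ?thesis .
      qed
      then show ?case
        using c step.hyps by (intro exI[of _ "c(i := v)"]) auto
    qed
    \<comment> \<open>At i = 0 the derivative term is 0, so a single constant vector
      \<open>A\<close> remains; S = I shows that it vanishes.\<close>
    from this[of 0] obtain c A where c: "c r = w"
      and cA: "\<And>S. (\<Sum>j\<le>r. ?u1 j S *v c j) = u S *v A"
      by (auto simp: monom_0 functional_zero[OF left_linear] atMost_atLeast0)
    have "mp_deriv [:mat 1:] = (0 :: 'm cmat poly)"
      by (simp add: poly_eq_iff coeff_mp_deriv)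
    then have "u [:mat 1:] *v A = 0"
      unfolding cA[symmetric] by (simp add: functional_zero[OF left_linear])
    then have "A = 0" by (rule invertible_kernel[OF invertible_moment_0])
    then have "(\<Sum>j\<le>r. u (scalar_mp \<alpha> \<odot> (mp_X j \<odot> T)) *v c j) = 0" for T
      using cA mp_deriv_surj[of T] by auto
    then have "c r = 0" by (rule alpha_monom_kernel)
    with c w show False by simp
  qed
qed

text \<open>The product rule D(u \<alpha> \<alpha>) = D(u \<alpha>) \<alpha> + u \<alpha> \<alpha>'
  gives the new \<Psi>. By \<open>deriv_orthogonal\<close> the derivative of P_{n+1} is orthogonal
  for u \<alpha>, and its pairing with x^n is - E_{n+1} M_n, invertible by
  \<open>invertible_M\<close>. The factor 1/(n+1) makes it monic.\<close>

lemma shift: "pearson_MOP (\<lambda>S. u (scalar_mp \<alpha> \<odot> S)) \<alpha> (\<Psi> + scalar_mp (pderiv \<alpha>))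
    (\<lambda>n. [:mat (1 / of_nat (Suc n)):] \<odot> mp_deriv (P (Suc n)))"
    (is "pearson_MOP ?u _ ?\<Psi> ?P")
proof
  show lin: "left_linear ?u"
    unfolding left_linear_def
    by (simp add: mp_mult_distrib functional_add[OF left_linear] scalar_mp_left_commute[of "[:_:]", symmetric]
        functional_const_mult[OF left_linear])
  show "\<alpha> \<noteq> 0" "degree \<alpha> \<le> 2" by (fact alpha_nonzero degree_alpha)+
  have deg: "degree (pderiv \<alpha>) \<le> 1"
    using degree_alpha by (simp add: degree_pderiv)
  then have "degree (scalar_mp (pderiv \<alpha>) :: 'm cmat poly) \<le> 1"
    by (intro degree_le) (simp add: coeff_scalar_mp coeff_eq_0)
  then show "degree ?\<Psi> \<le> 1"
    by (intro degree_add_le degree_Psi)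
  show "pearson ?u \<alpha> ?\<Psi>"
    unfolding pearson_def fun_deriv_def
  proof
    fix S
    have "fun_mult ?u ?\<Psi> S = ?u S ** coeff \<Psi> 0 + ?u (mp_X 1 \<odot> S) ** coeff \<Psi> 1 +
        ?u (scalar_mp (pderiv \<alpha>) \<odot> S)"
      by (simp add: fun_mult_add fun_mult_eq_sum[OF degree_Psi] fun_mult_scalar[OF lin] monom_0)
    moreover have "?u (mp_X 1 \<odot> S) = u (scalar_mp (monom 1 1 * \<alpha>) \<odot> S)"
      by (metis scalar_scalar_mp_mult mult.commute scalar_mp_monom)
    moreover have "?u (scalar_mp (pderiv \<alpha>) \<odot> S) = u (scalar_mp (\<alpha> * pderiv \<alpha>) \<odot> S)"
      by (simp add: scalar_scalar_mp_mult)
    ultimately show "- fun_mult ?u (scalar_mp \<alpha>) (mp_deriv S) = fun_mult ?u ?\<Psi> S"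
      unfolding fun_mult_scalar[OF lin] pearson_scalar_mult_deriv[of \<alpha> S] by simp
  qed
  have coeff_P1: "coeff (?P n) k = mscale (of_nat (Suc k) / of_nat (Suc n)) (coeff (P (Suc n)) (Suc k))" for n k
    by (simp add: coeff_const_mp_mult coeff_mp_deriv real_scaleR_eq_mscale mat_mult_eq_mscale del: of_nat_Suc)
  have lead: "coeff (?P n) n = mat 1" for n
    by (simp only: coeff_P1 coeff_P) (simp del: of_nat_Suc)
  moreover have "(mat 1 :: 'm cmat) \<noteq> 0" by (simp add: mat_def vec_eq_iff)
  moreover have "degree (?P n) \<le> n" for n
    by (rule degree_le) (simp add: coeff_P1 coeff_eq_0 degree_P del: of_nat_Suc)
  ultimately have degree: "degree (?P n) = n" for n
    by (metis le_antisym le_degree)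
  have u_P: "?u (mp_X k \<odot> ?P n) = mscale (1 / of_nat (Suc n)) (?u (mp_X k \<odot> mp_deriv (P (Suc n))))" for k n
    by (metis functional_const_mult[OF lin] mat_mult_eq_mscale(1) mp_mult_assoc scalar_mp_commute scalar_mp_monom)
  have "?u (mp_X k \<odot> ?P n) = 0" if "k < n" for k n
    unfolding u_P using deriv_orthogonal(1)[OF P_orthogonal, of n] that by (simp add: orthogonal_below_def)
  moreover have "invertible (?u (mp_X n \<odot> ?P n))" for n
    unfolding u_P deriv_orthogonal(2)[OF P_orthogonal]
    by (intro invertible_mscale invertible_uminus invertible_mult invertible_E invertible_M)
      (simp del: of_nat_Suc)
  ultimately show "monic_MOP ?u ?P"
    by (simp only: monic_MOP_def MOP_def degree lead invertible_mat_1) blast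
qed

text \<open>This is the zeroth moment of u \<alpha>, to which \<open>shift\<close> applies.\<close>

lemma invertible_functional_alpha: "invertible (u (scalar_mp \<alpha>))"
  using pearson_MOP.invertible_moment_0[OF shift] scalar_mp_commute[of \<alpha> "[:mat 1 :: 'm cmat:]"]
  by simp

end

section \<open>The differential operator and its pairing with u \<alpha>\<close>

abbreviation mp_ode :: "complex poly \<Rightarrow> 'm::finite cmat poly \<Rightarrow> nat \<Rightarrow> 'm cmat poly \<Rightarrow> 'm cmat poly" where
  "mp_ode \<alpha> \<Psi> n Q \<equiv> scalar_mp \<alpha> \<odot> mp_deriv (mp_deriv Q) + \<Psi> \<odot> mp_deriv Q
    - [:mscale (of_nat n) (M_mat (coeff \<alpha> 2) (coeff \<Psi> 1) (n - 1)):] \<odot> Q"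

context pearson_MOP
begin

abbreviation "ode \<equiv> mp_ode \<alpha> \<Psi>"

lemma Psi_mult: "\<Psi> \<odot> S = [:coeff \<Psi> 0:] \<odot> S + [:coeff \<Psi> 1:] \<odot> (mp_X 1 \<odot> S)"
proof -
  have "\<Psi> = [:coeff \<Psi> 0:] + [:coeff \<Psi> 1:] \<odot> mp_X 1"
    using degree_Psi
    by (auto simp: poly_eq_iff coeff_const_mp_mult coeff_pCons coeff_eq_0 split: nat.splits)
  then show ?thesis by (metis mp_mult_assoc mp_mult_distrib(2))
qed

text \<open>Here \<open>y0\<close> and \<open>y1\<close> are the pairings of Q' with \<alpha> and x
  \<alpha>. The Pearson equation reduces them to the moments \<open>d\<close> and \<open>e\<close>
  of \<open>Q\<close>, and reduces the pairing of Q'' to \<open>y0\<close> and \<open>y1\<close>.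
  The Q'' term is stated on its own because for n = 1 its vanishing is a relation between
  \<open>d\<close> and \<open>e\<close>.\<close>

lemma functional_ode:
  fixes Q :: "'m cmat poly"
  assumes "u Q = 0"
  defines "d \<equiv> u (mp_X 1 \<odot> Q)" and "e \<equiv> u (mp_X 2 \<odot> Q)"
  defines "y0 \<equiv> - (d ** coeff \<Psi> 1)"
    and "y1 \<equiv> - (d ** coeff \<Psi> 0 + e ** coeff \<Psi> 1) - (mscale (coeff \<alpha> 1) d + mscale (coeff \<alpha> 2) e)"
  shows "u (scalar_mp \<alpha> \<odot> (scalar_mp \<alpha> \<odot> mp_deriv (mp_deriv Q))) =
      - (y0 ** coeff \<Psi> 0 + y1 ** coeff \<Psi> 1) - (mscale (coeff \<alpha> 1) y0 + mscale (2 * coeff \<alpha> 2) y1)"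
    (is ?A)
    and "u (scalar_mp \<alpha> \<odot> ode n Q) =
      - (y0 ** coeff \<Psi> 0 + y1 ** coeff \<Psi> 1) - (mscale (coeff \<alpha> 1) y0 + mscale (2 * coeff \<alpha> 2) y1)
      + (coeff \<Psi> 0 ** y0 + coeff \<Psi> 1 ** y1)
      - mscale (of_nat n) (M (n - 1) ** (mscale (coeff \<alpha> 1) d + mscale (coeff \<alpha> 2) e))"
proof -
  have uQ: "u (scalar_mp \<alpha> \<odot> Q) = mscale (coeff \<alpha> 1) d + mscale (coeff \<alpha> 2) e"
    using functional_scalar_eq_sum[OF left_linear degree_alpha, of Q] assms(1)
    by (simp add: d_def e_def monom_0 numeral_2_eq_2)
  have y0: "u (scalar_mp \<alpha> \<odot> mp_deriv Q) = y0"
    unfolding pearson_deriv assms(1) by (simp add: y0_def d_def)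
  have y1: "u (scalar_mp \<alpha> \<odot> (mp_X 1 \<odot> mp_deriv Q)) = y1"
    using pearson_scalar_mult_deriv[of "monom 1 1" Q] uQ
    by (simp add: y1_def d_def e_def scalar_mp_monom mult_monom pderiv_monom numeral_2_eq_2 monom_0
        flip: one_pCons)
  have deg: "degree (pderiv \<alpha>) \<le> 1" using degree_alpha by (simp add: degree_pderiv)
  have "u (scalar_mp (monom 1 1 * \<alpha>) \<odot> mp_deriv Q) = y1"
    using y1 by (metis scalar_scalar_mp_mult mult.commute scalar_mp_monom)
  moreover have "u (scalar_mp (\<alpha> * pderiv \<alpha>) \<odot> mp_deriv Q) = mscale (coeff \<alpha> 1) y0 + mscale (2 * coeff \<alpha> 2) y1"
    using functional_linear_scalar[OF pearson_MOP.left_linear[OF shift] deg, of "mp_deriv Q"]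
    unfolding y0 y1 by (simp add: scalar_scalar_mp_mult coeff_pderiv numeral_2_eq_2)
  ultimately show A: ?A
    unfolding pearson_scalar_mult_deriv y0 by simp
  have "u (scalar_mp \<alpha> \<odot> (\<Psi> \<odot> mp_deriv Q)) = coeff \<Psi> 0 ** y0 + coeff \<Psi> 1 ** y1"
    unfolding Psi_mult y0[symmetric] y1[symmetric]
    by (simp add: mp_mult_distrib functional_add[OF left_linear] scalar_mp_left_commute[of "[:_:]", symmetric]
        functional_const_mult[OF left_linear])
  moreover have "u (scalar_mp \<alpha> \<odot> ([:mscale (of_nat n) (M (n - 1)):] \<odot> Q)) =
     mscale (of_nat n) (M (n - 1) ** (mscale (coeff \<alpha> 1) d + mscale (coeff \<alpha> 2) e))"
    unfolding uQ[symmetric]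
    by (simp add: functional_const_mult[OF left_linear] mscale_mult_left
      flip: scalar_mp_left_commute[of "[:_:]"])
  ultimately show "u (scalar_mp \<alpha> \<odot> ode n Q) =
      - (y0 ** coeff \<Psi> 0 + y1 ** coeff \<Psi> 1) - (mscale (coeff \<alpha> 1) y0 + mscale (2 * coeff \<alpha> 2) y1)
      + (coeff \<Psi> 0 ** y0 + coeff \<Psi> 1 ** y1)
      - mscale (of_nat n) (M (n - 1) ** (mscale (coeff \<alpha> 1) d + mscale (coeff \<alpha> 2) e))"
    using A by (simp add: mp_mult_distrib functional_add[OF left_linear] functional_diff[OF left_linear])
qed

text \<open>V_n is invertible and commutes with \<open>\<psi>\<^sub>1\<close>, hence so does its
  inverse, and \<open>d\<close> is a scalar multiple of that inverse.\<close>

lemma commute_of_V_mult: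
  assumes "V_mat (coeff \<alpha> 2) (coeff \<Psi> 1) n ** d = mat s"
  shows "d ** coeff \<Psi> 1 = coeff \<Psi> 1 ** d"
proof (rule invertible_mult_left_cancel[OF invertible_V_mat[OF invertible_M]])
  let ?V = "V_mat (coeff \<alpha> 2) (coeff \<Psi> 1) n"
  have "?V ** (d ** coeff \<Psi> 1) = mat s ** coeff \<Psi> 1"
    unfolding matrix_mul_assoc assms ..
  also have "\<dots> = coeff \<Psi> 1 ** ?V ** d"
    unfolding matrix_mul_assoc[symmetric] assms by (rule mat_commute)
  also have "\<dots> = ?V ** (coeff \<Psi> 1 ** d)"
    unfolding V_mat_commute[symmetric] matrix_mul_assoc ..
  finally show "?V ** (d ** coeff \<Psi> 1) = ?V ** (coeff \<Psi> 1 ** d)" .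
qed

text \<open>For n = 1 orthogonality removes neither \<open>d\<close> nor \<open>e\<close>. As
  \<open>Q\<close> is linear, Q'' = 0, and the resulting relation eliminates \<open>e\<close>. What
  remains is the commutator of V_0 d with \<open>\<psi>\<^sub>0\<close>, zero because V_0 d is
  scalar.\<close>

lemma functional_ode_eq_0_Suc_0:
  assumes "degree Q \<le> 1" "orthogonal_below u 1 Q"
    and V: "V_mat (coeff \<alpha> 2) (coeff \<Psi> 1) 0 ** u (mp_X 1 \<odot> Q) = mat s"
  shows "u (scalar_mp \<alpha> \<odot> ode 1 Q) = 0"
proof -
  define d e where "d = u (mp_X 1 \<odot> Q)" and "e = u (mp_X 2 \<odot> Q)"
  define p q a1 a2 where "p = coeff \<Psi> 0" and "q = coeff \<Psi> 1" and "a1 = coeff \<alpha> 1" and "a2 = coeff \<alpha> 2"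
  define y0 y1 where "y0 = - (d ** q)" and "y1 = - (d ** p + e ** q) - (mscale a1 d + mscale a2 e)"
  note defs = d_def e_def p_def q_def a1_def a2_def y0_def y1_def
  have uQ: "u Q = 0" using assms(2) by (simp add: orthogonal_below_def monom_0)
  have dq: "d ** q = q ** d"
    using commute_of_V_mult[OF V] by (simp add: d_def q_def)
  then have dq': "d ** (q ** X) = q ** (d ** X)" for X by (simp add: matrix_mul_assoc)
  have M1: "M 1 = q + mat a2" and M0: "M 0 = q" by (simp_all add: M_mat_def q_def a2_def)
  have V: "q ** (q ** d) + mscale a2 (q ** d) = mat s"
    using V unfolding V_mat_0 M1 M0 by (simp add: d_def mat_ring_simps)
  have "degree (mp_deriv (mp_deriv Q)) \<le> 0" "degree (mp_deriv Q) \<le> 0"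
    using degree_mp_deriv_le[of Q] degree_mp_deriv_le[of "mp_deriv Q"] assms(1) by linarith+
  then have "mp_deriv (mp_deriv Q) = 0"
    using assms(1) by (intro poly_eqI) (simp add: coeff_mp_deriv coeff_eq_0)
  then have "- (y0 ** p + y1 ** q) - (mscale a1 y0 + mscale (2 * a2) y1) = 0"
    using functional_ode(1)[OF uQ] by (simp add: defs functional_zero[OF left_linear])
  then have y1: "y1 ** q + mscale (2 * a2) y1 = d ** q ** p + mscale a1 (d ** q)"
    by (simp add: y0_def mat_ring_simps algebra_simps eq_neg_iff_add_eq_0)
  \<comment> \<open>\<open>N\<close> is \<open>M 2\<close>. Right multiplication by it turns
    \<open>y1\<close> into the left-hand side of the relation just obtained, and it commutes with
    \<open>M 1\<close>.\<close>
  define N where "N = q + mat (2 * a2)"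
  have "e ** M 1 = - (y1 + d ** p + mscale a1 d)"
    unfolding M1 by (simp add: y1_def mat_ring_simps)
  then have "e ** M 1 ** N = - (y1 ** N + d ** p ** N + mscale a1 (d ** N))"
    by (simp only:) (simp add: mat_ring_simps)
  also have "y1 ** N = d ** q ** p + mscale a1 (d ** q)"
    unfolding y1[symmetric] by (simp add: N_def mat_ring_simps)
  finally have eN: "e ** N ** M 1 =
      - (d ** q ** p + mscale a1 (d ** q) + d ** p ** N + mscale a1 (d ** N))"
    unfolding M1 by (simp add: N_def mat_ring_simps algebra_simps)
  \<comment> \<open>The second moment \<open>e\<close> is known only through \<open>e ** N ** M 1\<close>, so \<open>?Z = 0\<close> is checked after
    multiplication by \<open>M 1\<close> on the right.\<close>
  let ?Z = "p ** y0 + q ** y1 - q ** (mscale a1 d + mscale a2 e)"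
  have "?Z = - (p ** d ** q) - q ** (d ** p) - mscale (2 * a1) (q ** d) - q ** (e ** N)"
    by (simp add: y0_def y1_def N_def mat_ring_simps)
      (simp add: mscale_def vec_eq_iff algebra_simps)
  then have "?Z ** M 1 = - (p ** d ** q) ** M 1 - q ** (d ** p) ** M 1 - mscale (2 * a1) (q ** d) ** M 1
      - q ** (e ** N ** M 1)"
    by (simp only: matrix_diff_distrib matrix_mul_assoc)
  also have "\<dots> = (q ** (q ** d) + mscale a2 (q ** d)) ** p - p ** (q ** (q ** d) + mscale a2 (q ** d))"
    unfolding eN unfolding M1 by (simp only: N_def mat_ring_simps dq dq' mscale_simps)
      (simp add: mscale_def vec_eq_iff algebra_simps)
  also have "\<dots> = 0"
    unfolding V by (simp add: mat_mult_eq_mscale)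
  finally have "?Z = 0"
    using invertible_mult_right_cancel[OF invertible_M[of 1], of ?Z 0] by simp
  then show ?thesis
    using functional_ode(2)[OF uQ, of 1] M0
      \<open>- (y0 ** p + y1 ** q) - (mscale a1 y0 + mscale (2 * a2) y1) = 0\<close>
    by (simp add: defs)
qed

text \<open>Here the first moment of \<open>Q\<close> is 0, and for n > 2 the second one too. For n
  = 2 the terms with the second moment cancel because it commutes with
  \<open>\<psi>\<^sub>1\<close>, by the normalisation with V.\<close>

lemma functional_ode_eq_0:
  assumes "n \<ge> 2" "orthogonal_below u n Q"
    and V: "V_mat (coeff \<alpha> 2) (coeff \<Psi> 1) (n - 1) ** u (mp_X n \<odot> Q) = mat s"
  shows "u (scalar_mp \<alpha> \<odot> ode n Q) = 0"
proof -
  have uQ: "u Q = 0" and d: "u (mp_X 1 \<odot> Q) = 0"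
    using assms(1,2) unfolding orthogonal_below_def by (auto dest: spec[of _ 0] simp: monom_0)
  show ?thesis
  proof (cases "n = 2")
    case True
    have "u (mp_X 2 \<odot> Q) ** coeff \<Psi> 1 = coeff \<Psi> 1 ** u (mp_X 2 \<odot> Q)"
      using commute_of_V_mult[OF V] True by simp
    then show ?thesis
      unfolding functional_ode(2)[OF uQ] d using True
      by (simp add: M_mat_def mat_ring_simps) (simp add: mscale_def vec_eq_iff algebra_simps)
  next
    case False
    then have "u (mp_X 2 \<odot> Q) = 0"
      using assms(1,2) unfolding orthogonal_below_def by simp
    then show ?thesis unfolding functional_ode(2)[OF uQ] d by simp
  qed
qed

lemma ode_eq_0:
  assumes "mp_deriv (ode n Q) = 0" "u (scalar_mp \<alpha> \<odot> ode n Q) = 0"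
  shows "ode n Q = 0"
proof -
  obtain c where c: "ode n Q = [:c:]"
    using mp_deriv_eq_0D[OF assms(1)] by blast
  have "c ** u (scalar_mp \<alpha>) = u ([:c:] \<odot> scalar_mp \<alpha>)"
    by (simp add: functional_const_mult[OF left_linear])
  also have "\<dots> = 0"
    using assms(2) unfolding c by (simp add: scalar_mp_commute)
  finally have "c = 0"
    using invertible_mult_right_cancel[OF invertible_functional_alpha, of c 0] by simp
  then show ?thesis using c by simp
qed

text \<open>Differentiation moves \<alpha>' Q'' into the first-order term and
  \<open>\<psi>\<^sub>1\<close> Q' into the zeroth-order one.\<close>

lemma mp_deriv_ode:
  "mp_deriv (ode (Suc n) Q) = mp_ode \<alpha> (\<Psi> + scalar_mp (pderiv \<alpha>)) n (mp_deriv Q)"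
proof -
  have Psi: "mp_deriv \<Psi> = [:coeff \<Psi> 1:]"
    using degree_Psi by (auto simp: poly_eq_iff coeff_mp_deriv coeff_pCons coeff_eq_0 split: nat.splits)
  \<comment> \<open>With M_n = \<open>\<psi>\<^sub>1\<close> + n \<open>\<alpha>\<^sub>2\<close> I
    the left side is -n M_{n+1}, and for n > 0 the shifted M_{n-1} is M_{n+1}. For n = 0 both sides
    are 0.\<close>
  have M: "coeff \<Psi> 1 - mscale (of_nat (Suc n)) (M n) =
      - mscale (of_nat n) (M_mat (coeff \<alpha> 2) (coeff (\<Psi> + scalar_mp (pderiv \<alpha>)) 1) (n - 1))"
  proof (cases n)
    case (Suc k)
    have "coeff (\<Psi> + scalar_mp (pderiv \<alpha>)) 1 = coeff \<Psi> 1 + mat (2 * coeff \<alpha> 2)"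
      by (simp add: coeff_scalar_mp coeff_pderiv numeral_2_eq_2)
    then show ?thesis
      unfolding Suc by (simp only: M_mat_shift diff_Suc_1)
        (simp add: M_mat_def mscale_def mat_def vec_eq_iff algebra_simps)
  qed (simp add: M_mat_def)
  have "mp_deriv (ode (Suc n) Q) = scalar_mp \<alpha> \<odot> mp_deriv (mp_deriv (mp_deriv Q)) +
      (\<Psi> + scalar_mp (pderiv \<alpha>)) \<odot> mp_deriv (mp_deriv Q) +
      [:coeff \<Psi> 1 - mscale (of_nat (Suc n)) (M n):] \<odot> mp_deriv Q"
    by (simp add: mp_deriv_add mp_deriv_diff mp_deriv_scalar_mult mp_deriv_mult[of \<Psi>] Psi
        mp_deriv_const_mult mp_mult_distrib mp_mult_distrib(4)[of "[:_:]" "[:_:]", simplified]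
        algebra_simps del: of_nat_Suc)
  then show ?thesis
    unfolding M using mp_mult_distrib(6)[of "[:_:]"] by simp
qed

section \<open>Uniqueness of orthogonal sequences\<close>

lemma P_expansion:
  assumes "\<And>k. k \<ge> n \<Longrightarrow> coeff T k = 0"
  shows "\<exists>A. T = (\<Sum>j<n. [:A j:] \<odot> P j)"
  using assms
proof (induction n arbitrary: T)
  case 0
  then show ?case by (simp add: poly_eq_iff)
next
  case (Suc n)
  \<comment> \<open>Subtracting this multiple of the monic \<open>P n\<close> removes the
    coefficient of x^n. Bounding the degree through coefficients lets n = 0 mean T = 0.\<close>
  have "\<exists>A. T - [:coeff T n:] \<odot> P n = (\<Sum>j<n. [:A j:] \<odot> P j)"
  proof (rule Suc.IH)
    fix k assume "k \<ge> n"
    then show "coeff (T - [:coeff T n:] \<odot> P n) k = 0"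
      using Suc.prems[of k] coeff_eq_0[of "P n" k]
      by (cases "k = n") (simp_all add: coeff_const_mp_mult coeff_P degree_P)
  qed
  then obtain A where A: "T - [:coeff T n:] \<odot> P n = (\<Sum>j<n. [:A j:] \<odot> P j)" ..
  have "T = (\<Sum>j<Suc n. [:(A(n := coeff T n)) j:] \<odot> P j)"
    using A by (simp add: algebra_simps)
  then show ?case by blast
qed

text \<open>Pairing the expansion with x^k gives a triangular system: terms with j > k vanish by
  orthogonality, those with j < k by induction, and E_k is invertible.\<close>

lemma orthogonal_below_eq_0:
  assumes "\<And>k. k \<ge> n \<Longrightarrow> coeff T k = 0" "orthogonal_below u n T"
  shows "T = 0"
proof -
  obtain A where T: "T = (\<Sum>j<n. [:A j:] \<odot> P j)" using P_expansion[OF assms(1)] by blast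
  have "A k = 0" if "k < n" for k
    using that
  proof (induction k rule: less_induct)
    case (less k)
    have "mp_X k \<odot> T = (\<Sum>j<n. [:A j:] \<odot> (mp_X k \<odot> P j))"
      unfolding T scalar_mp_monom[symmetric]
      by (simp add: scalar_mp_left_commute[of "[:_:]"] mp_mult_sum_left scalar_mp_commute[of "monom 1 k"]
          mp_mult_assoc)
    then have "u (mp_X k \<odot> T) = (\<Sum>j<n. A j ** u (mp_X k \<odot> P j))"
      by (simp add: functional_sum[OF left_linear] functional_const_mult[OF left_linear])
    also have "\<dots> = (\<Sum>j<n. if j = k then A k ** u (mp_X k \<odot> P k) else 0)"
    proof (rule sum.cong)
      fix j assume "j \<in> {..<n}"
      then show "A j ** u (mp_X k \<odot> P j) = (if j = k then A k ** u (mp_X k \<odot> P k) else 0)"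
        using less.IH[of j] P_orthogonal[of j] unfolding orthogonal_below_def
        by (cases j k rule: linorder_cases) auto
    qed simp
    also have "\<dots> = A k ** u (mp_X k \<odot> P k)"
      using less.prems by simp
    finally have "A k ** u (mp_X k \<odot> P k) = 0"
      using assms(2) less.prems by (simp add: orthogonal_below_def)
    then show ?case
      using invertible_mult_right_cancel[OF invertible_E[of k], of "A k" 0] by simp
  qed
  then show ?thesis by (simp add: T)
qed

lemma functional_monom_const_mult: "u (mp_X k \<odot> ([:A:] \<odot> S)) = A ** u (mp_X k \<odot> S)"
  by (metis functional_const_mult[OF left_linear] scalar_mp_left_commute scalar_mp_monom)

text \<open>The difference of the two sides has degree below n and keeps the orthogonality, so it is
  0.\<close>

lemma MOP_eq_lead_coeff_mult:
  assumes "MOP u Q"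
  shows "Q n = [:lead_coeff (Q n):] \<odot> P n"
proof -
  have Q: "degree (Q n) = n" "orthogonal_below u n (Q n)"
    using assms by (auto simp: MOP_def orthogonal_below_def)
  have "Q n - [:lead_coeff (Q n):] \<odot> P n = 0"
  proof (rule orthogonal_below_eq_0)
    fix k assume "k \<ge> n"
    then show "coeff (Q n - [:lead_coeff (Q n):] \<odot> P n) k = 0"
      using coeff_eq_0[of "P n" k] coeff_eq_0[of "Q n" k] Q(1)
      by (cases "k = n") (simp_all add: coeff_const_mp_mult coeff_P degree_P)
  next
    show "orthogonal_below u n (Q n - [:lead_coeff (Q n):] \<odot> P n)"
      using Q(2) P_orthogonal[of n]
      by (simp add: orthogonal_below_def mp_mult_distrib functional_diff[OF left_linear]
          functional_monom_const_mult)
  qed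
  then show ?thesis by simp
qed

end

text \<open>Differentiating the equation for \<open>(u, \<Psi>, n + 1)\<close> gives the equation for
  \<open>(u \<alpha>, \<Psi> + \<alpha>', n)\<close>, so by induction its left-hand side is a constant; it vanishes because it is
  annihilated by \<open>u \<alpha>\<close>. The normalisation \<open>V\<^sub>n \<langle>x\<^sup>n\<^sup>+\<^sup>1 Q, u\<rangle> = s I\<close> is passed on with \<open>- s\<close> in place of \<open>s\<close>.\<close>

lemma pearson_MOP_ode:
  assumes "pearson_MOP u \<alpha> \<Psi> P" "degree Q \<le> Suc n" "orthogonal_below u (Suc n) Q"
    and "V_mat (coeff \<alpha> 2) (coeff \<Psi> 1) n ** u (mp_X (Suc n) \<odot> Q) = mat s"
  shows "mp_ode \<alpha> \<Psi> (Suc n) Q = 0"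
  using assms
proof (induction n arbitrary: u \<Psi> P Q s)
  case 0
  interpret pearson_MOP u \<alpha> \<Psi> P by fact
  have "mp_deriv (mp_deriv Q) = 0"
    using 0(2) by (intro poly_eqI) (simp add: coeff_mp_deriv coeff_eq_0)
  moreover from this have "mp_deriv (mp_deriv (mp_deriv Q)) = 0"
    by (simp add: poly_eq_iff coeff_mp_deriv)
  \<comment> \<open>By \<open>mp_deriv_ode\<close> this derivative is the operator for n = 0 applied
    to Q', and its zeroth-order coefficient carries the factor 0.\<close>
  ultimately have "mp_deriv (ode (Suc 0) Q) = 0"
    unfolding mp_deriv_ode by simp
  moreover have "u (scalar_mp \<alpha> \<odot> ode 1 Q) = 0"
    using 0 by (intro functional_ode_eq_0_Suc_0[of _ s]) simp_all
  ultimately show ?case by (intro ode_eq_0) simp_all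
next
  case (Suc n)
  interpret pearson_MOP u \<alpha> \<Psi> P by fact
  let ?\<Psi> = "\<Psi> + scalar_mp (pderiv \<alpha>)"
  let ?D = "u (mp_X (Suc (Suc n)) \<odot> Q)"
  have "coeff ?\<Psi> 1 = coeff \<Psi> 1 + mat (2 * coeff \<alpha> 2)"
    by (simp add: coeff_scalar_mp coeff_pderiv numeral_2_eq_2)
  then have V: "M (Suc n) ** (V_mat (coeff \<alpha> 2) (coeff ?\<Psi> 1) n ** ?D) = mat s"
    using Suc.prems(4) by (simp add: V_mat_Suc matrix_mul_assoc)
  \<comment> \<open>\<open>V_mat_Suc\<close> has \<open>M (Suc n)\<close> on the left, whereas
    \<open>deriv_orthogonal\<close> produces it on the right. The product is scalar and
    \<open>M (Suc n)\<close> is invertible, so the factors may be swapped.\<close>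
  have "V_mat (coeff \<alpha> 2) (coeff ?\<Psi> 1) n ** ?D ** M (Suc n) = mat s"
    by (rule invertible_mult_left_cancel[OF invertible_M[of "Suc n"]])
      (metis V mat_commute matrix_mul_assoc)
  then have "V_mat (coeff \<alpha> 2) (coeff ?\<Psi> 1) n ** u (scalar_mp \<alpha> \<odot> (mp_X (Suc n) \<odot> mp_deriv Q)) = mat (- s)"
    unfolding deriv_orthogonal(2)[OF Suc.prems(3)]
    by (simp add: matrix_mult_uminus matrix_mul_assoc mat_eq_mscale[of s] mat_eq_mscale[of "- s"] mscale_distrib)
  moreover have "degree (mp_deriv Q) \<le> Suc n"
    using degree_mp_deriv_le[of Q] Suc.prems(2) by linarith
  ultimately have "mp_ode \<alpha> ?\<Psi> (Suc n) (mp_deriv Q) = 0"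
    using deriv_orthogonal(1)[OF Suc.prems(3)] by (intro Suc.IH[OF shift])
  then have "mp_deriv (ode (Suc (Suc n)) Q) = 0"
    unfolding mp_deriv_ode .
  moreover have "u (scalar_mp \<alpha> \<odot> ode (Suc (Suc n)) Q) = 0"
    using Suc.prems by (intro functional_ode_eq_0[of _ _ s]) simp_all
  ultimately show ?case by (rule ode_eq_0)
qed

section \<open>From the normalised left multiples to both equations\<close>

theorem theorem4p3:
  fixes u :: "('m::finite) functional"
    and \<alpha>\<^sub>0 \<alpha>\<^sub>1 \<alpha>\<^sub>2 :: complex
    and \<psi>\<^sub>0 \<psi>\<^sub>1 :: "'m cmat"
    and \<alpha> :: "complex poly"
    and \<Psi> :: "'m cmat poly"
    and M V E :: "nat \<Rightarrow> 'm cmat"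
    and P :: "nat \<Rightarrow> 'm cmat poly"
  defines "\<alpha> \<equiv> [:\<alpha>\<^sub>0, \<alpha>\<^sub>1, \<alpha>\<^sub>2:]"
    and "\<Psi> \<equiv> [:\<psi>\<^sub>0, \<psi>\<^sub>1:]"
    and "M \<equiv> M_mat \<alpha>\<^sub>2 \<psi>\<^sub>1"
    and "V \<equiv> V_mat \<alpha>\<^sub>2 \<psi>\<^sub>1"
    and "E \<equiv> (\<lambda>n. u (mp_X n \<odot> P n))"
  assumes "zero_class_functional u"
    and "\<alpha> \<noteq> 0"
    and "pearson u \<alpha> \<Psi>"
    and "monic_MOP u P"
  shows "(\<forall>n\<ge>1.
            scalar_mp \<alpha> \<odot> mp_deriv (mp_deriv (P n))
            + [:E n:] \<odot> [:V (n - 1):] \<odot> \<Psi> \<odot> [:matrix_inv (V (n - 1)):] \<odot> [:matrix_inv (E n):]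
                \<odot> mp_deriv (P n)
            - [:real n *\<^sub>R (E n ** M (n - 1) ** matrix_inv (E n)):] \<odot> P n = 0)
       \<and> (\<forall>Q. MOP u Q \<and> (\<forall>n\<ge>1. lead_coeff (Q n) = matrix_inv (E n ** V (n - 1))) \<longrightarrow>
            (\<forall>n\<ge>1.
              scalar_mp \<alpha> \<odot> mp_deriv (mp_deriv (Q n))
              + \<Psi> \<odot> mp_deriv (Q n)
              - [:real n *\<^sub>R M (n - 1):] \<odot> Q n = 0))"
proof -
  interpret pearson_MOP u \<alpha> \<Psi> P
    using assms(6-9)
    by unfold_locales (auto simp: zero_class_functional_def \<alpha>_def \<Psi>_def)
  have coeffs: "coeff \<alpha> 2 = \<alpha>\<^sub>2" "coeff \<Psi> 1 = \<psi>\<^sub>1"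
    by (simp_all add: \<alpha>_def \<Psi>_def numeral_2_eq_2)
  have inv_E: "invertible (E n)" and inv_V: "invertible (V n)" for n
    using invertible_E invertible_V_mat[OF invertible_M, of n]
    unfolding E_def V_def coeffs by simp_all
  define K where "K n = E n ** V (n - 1)" for n
  have inv_K: "invertible (K n)" for n
    unfolding K_def by (intro invertible_mult inv_E inv_V)
  define R where "R n = [:matrix_inv (K n):] \<odot> P n" for n
  have ode_R: "scalar_mp \<alpha> \<odot> mp_deriv (mp_deriv (R n)) + \<Psi> \<odot> mp_deriv (R n)
      - [:real n *\<^sub>R M (n - 1):] \<odot> R n = 0" if "n \<ge> 1" for n
  proof -
    have "degree (R n) \<le> n"
      by (rule degree_le) (simp add: R_def coeff_const_mp_mult coeff_eq_0 degree_P)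
    moreover have "orthogonal_below u n (R n)"
      using P_orthogonal[of n] by (simp add: R_def orthogonal_below_def functional_monom_const_mult)
    \<comment> \<open>The pairing of \<open>R n\<close> with x^n is the inverse of V_{n-1}, so
      \<open>pearson_MOP_ode\<close> applies with s = 1.\<close>
    moreover have "V (n - 1) ** u (mp_X n \<odot> R n) = mat 1"
    proof (rule invertible_mult_left_cancel[OF inv_E[of n]])
      have "E n ** (V (n - 1) ** u (mp_X n \<odot> R n)) = K n ** (matrix_inv (K n) ** E n)"
        by (simp add: R_def functional_monom_const_mult K_def E_def matrix_mul_assoc)
      then show "E n ** (V (n - 1) ** u (mp_X n \<odot> R n)) = E n ** mat 1"
        by (simp add: matrix_inv_cancel[OF inv_K])
    qed
    moreover have "Suc (n - 1) = n" using that by simp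
    ultimately have "ode n (R n) = 0"
      using pearson_MOP_ode[OF pearson_MOP_axioms, of "R n" "n - 1" 1]
      unfolding coeffs V_def by presburger
    then show ?thesis
      unfolding coeffs M_def real_scaleR_eq_mscale .
  qed
  have "scalar_mp \<alpha> \<odot> mp_deriv (mp_deriv (P n))
      + [:E n:] \<odot> [:V (n - 1):] \<odot> \<Psi> \<odot> [:matrix_inv (V (n - 1)):] \<odot> [:matrix_inv (E n):]
          \<odot> mp_deriv (P n)
      - [:real n *\<^sub>R (E n ** M (n - 1) ** matrix_inv (E n)):] \<odot> P n = 0" if "n \<ge> 1" for n
  proof -
    let ?E = "E n" and ?V = "V (n - 1)" and ?M = "M (n - 1)"
    have K': "matrix_inv (K n) = matrix_inv ?V ** matrix_inv ?E"
      by (rule invertible_mult_left_cancel[OF inv_K[of n]])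
        (simp add: matrix_inv_mult[OF inv_K], simp add: K_def matrix_mul_assoc[symmetric]
          matrix_inv_cancel[OF inv_V] matrix_inv_mult[OF inv_E])
    \<comment> \<open>Because of this, conjugating M_{n-1} by E_n V_{n-1} is the same as conjugating
      it by E_n alone.\<close>
    have "?V ** ?M = ?M ** ?V"
      unfolding V_def M_def by (rule M_mat_commute[OF V_mat_commute])
    then have KM: "K n ** ?M ** matrix_inv (K n) = ?E ** ?M ** matrix_inv ?E"
      unfolding K' by (simp add: K_def matrix_mul_assoc[symmetric])
        (simp add: matrix_mul_assoc[of ?V ?M] matrix_inv_cancel[OF inv_V] flip: matrix_mul_assoc[of ?M ?V])
    \<comment> \<open>Left multiplication by \<open>K n\<close> turns the equation of
      \<open>R n\<close> into one for \<open>P n\<close> with conjugated coefficients.\<close>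
    have "0 = [:K n:] \<odot> (scalar_mp \<alpha> \<odot> mp_deriv (mp_deriv (R n)) + \<Psi> \<odot> mp_deriv (R n)
        - [:real n *\<^sub>R ?M:] \<odot> R n)"
      by (simp only: ode_R[OF that] mp_mult_zero)
    also have "\<dots> = scalar_mp \<alpha> \<odot> mp_deriv (mp_deriv (P n)) +
        [:K n:] \<odot> (\<Psi> \<odot> ([:matrix_inv (K n):] \<odot> mp_deriv (P n))) -
        [:real n *\<^sub>R (K n ** ?M ** matrix_inv (K n)):] \<odot> P n"
      by (simp add: R_def mp_deriv_const_mult mp_mult_distrib scalar_mp_left_commute[of "[:_:]"]
          const_const_mp_mult matrix_inv_mult[OF inv_K] real_scaleR_eq_mscale mscale_mult_left
          mscale_mult_right matrix_mul_assoc)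
    finally show ?thesis
      unfolding KM unfolding K' unfolding K_def const_const_mp_mult[symmetric] mp_mult_assoc by simp
  qed
  moreover have "scalar_mp \<alpha> \<odot> mp_deriv (mp_deriv (Q n)) + \<Psi> \<odot> mp_deriv (Q n)
      - [:real n *\<^sub>R M (n - 1):] \<odot> Q n = 0"
    if "MOP u Q" "\<forall>n\<ge>1. lead_coeff (Q n) = matrix_inv (E n ** V (n - 1))" "n \<ge> 1" for Q n
  proof -
    have "Q n = R n"
      using MOP_eq_lead_coeff_mult[OF that(1), of n] that(2,3) by (simp add: R_def K_def)
    then show ?thesis using ode_R[OF that(3)] by simp
  qed
  ultimately show ?thesis by blast
qed

end
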